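(* Let $p>1$ be real with $p\neq2$, and let $S_p=\{(x,y)\in\mathbb{R}^2:|x|^p+|y|^p=1\}$. For small $\varepsilon>0$ (in particular $2\varepsilon<1$) let $$u_j=1-\bigl(1-(j\varepsilon)^p\bigr)^{1/p}\qquad(j=1,2),$$ so that, in the affine coordinates $(u,y)$ with $u=1-x$, the five points of $S_p$ with $x>0$ and $y=0,\pm\varepsilon,\pm2\varepsilon$ are $(0,0)$, $(u_1,\pm\varepsilon)$, $(u_2,\pm2\varepsilon)$. Then for all sufficiently small $\varepsilon>0$ the unique conic through these five points is $$(4u_1-u_2)\,u^2+\frac{u_1u_2(u_1-u_2)}{\varepsilon^{2}}\,y^2+(u_2^2-4u_1^2)\,u=0,$$ and it is a nondegenerate ellipse when $p>2$ and a nondegenerate hyperbola when $1<p<2$.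
   Context: A conic in the real plane with affine coordinates $(u,y)$ is given by an equation $F+Ey+Cy^2+Du+Buy+Au^2=0$ with real coefficients not all zero, two equations being identified if they are proportional; "unique" means unique up to a nonzero scalar multiple of the equation. The conic is nondegenerate if the associated symmetric $3\times3$ matrix of its homogenization is nonsingular. With discriminant $\Delta=B^2-4AC$, a nondegenerate hyperbola is a nondegenerate conic with $\Delta>0$, and a nondegenerate ellipse is a nondegenerate conic with $\Delta<0$ (and nonempty real locus). These notions are invariant under invertible affine changes of coordinates. *)

theory Defs
  imports "HOL-Analysis.Analysis"
begin

text \<open>
  The equation \<open>F + E y + C y^2 + D u + B u y + A u^2 = 0\<close>, given by its coefficients.
  It represents a conic if the coefficients are not all zero; proportional equations
  represent the same conic.
\<close>

datatype conic_eq =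
  Conic_Eq (cF: real) (cE: real) (cC: real) (cD: real) (cB: real) (cA: real)

definition is_conic :: "conic_eq \<Rightarrow> bool" where
  "is_conic q \<longleftrightarrow> q \<noteq> Conic_Eq 0 0 0 0 0 0"

definition scale_conic :: "real \<Rightarrow> conic_eq \<Rightarrow> conic_eq" where
  "scale_conic k q = Conic_Eq (k * cF q) (k * cE q) (k * cC q) (k * cD q) (k * cB q) (k * cA q)"

definition proportional :: "conic_eq \<Rightarrow> conic_eq \<Rightarrow> bool" where
  "proportional q q' \<longleftrightarrow> (\<exists>k. k \<noteq> 0 \<and> q' = scale_conic k q)"

definition locus :: "conic_eq \<Rightarrow> (real \<times> real) set" where
  "locus q = {(u, y). cF q + cE q * y + cC q * y\<^sup>2 + cD q * u + cB q * u * y + cA q * u\<^sup>2 = 0}"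

definition unique_conic_through :: "(real \<times> real) set \<Rightarrow> conic_eq \<Rightarrow> bool" where
  "unique_conic_through P q \<longleftrightarrow>
     is_conic q \<and> P \<subseteq> locus q \<and>
     (\<forall>q'. is_conic q' \<and> P \<subseteq> locus q' \<longrightarrow> proportional q q')"

text \<open>
  The symmetric matrix of the homogenized form
  \<open>F w^2 + E y w + C y^2 + D u w + B u y + A u^2\<close> in the variables \<open>(u, y, w)\<close>.
\<close>

definition conic_matrix :: "conic_eq \<Rightarrow> real^3^3" where
  "conic_matrix q = vector
     [vector [cA q,     cB q / 2, cD q / 2],
      vector [cB q / 2, cC q,     cE q / 2],
      vector [cD q / 2, cE q / 2, cF q]]"

definition nondegenerate :: "conic_eq \<Rightarrow> bool" where
  "nondegenerate q \<longleftrightarrow> invertible (conic_matrix q)"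

definition discriminant :: "conic_eq \<Rightarrow> real" where
  "discriminant q = (cB q)\<^sup>2 - 4 * cA q * cC q"

definition nondegenerate_hyperbola :: "conic_eq \<Rightarrow> bool" where
  "nondegenerate_hyperbola q \<longleftrightarrow> is_conic q \<and> nondegenerate q \<and> discriminant q > 0"

definition nondegenerate_ellipse :: "conic_eq \<Rightarrow> bool" where
  "nondegenerate_ellipse q \<longleftrightarrow>
     is_conic q \<and> nondegenerate q \<and> discriminant q < 0 \<and> locus q \<noteq> {}"

definition p_circle :: "real \<Rightarrow> (real \<times> real) set" where
  "p_circle p = {(x, y). \<bar>x\<bar> powr p + \<bar>y\<bar> powr p = 1}"

definition u_coord :: "real \<Rightarrow> real \<Rightarrow> nat \<Rightarrow> real" where
  "u_coord p \<epsilon> j = 1 - (1 - (real j * \<epsilon>) powr p) powr (1 / p)"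

definition five_points :: "real \<Rightarrow> real \<Rightarrow> (real \<times> real) set" where
  "five_points p \<epsilon> =
     {(0, 0), (u_coord p \<epsilon> 1, \<epsilon>), (u_coord p \<epsilon> 1, - \<epsilon>),
      (u_coord p \<epsilon> 2, 2 * \<epsilon>), (u_coord p \<epsilon> 2, - (2 * \<epsilon>))}"

definition five_point_conic :: "real \<Rightarrow> real \<Rightarrow> conic_eq" where
  "five_point_conic p \<epsilon> =
     (let u1 = u_coord p \<epsilon> 1; u2 = u_coord p \<epsilon> 2 in
      Conic_Eq 0 0 (u1 * u2 * (u1 - u2) / \<epsilon>\<^sup>2) (u2\<^sup>2 - 4 * u1\<^sup>2) 0 (4 * u1 - u2))"

end

theory Submission
  imports Defs "HOL-Real_Asymp.Real_Asymp"
begin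

text \<open>
  Reflection in the \<open>u\<close>-axis forces \<open>E = B = 0\<close> for any conic through the five points, and
  the two remaining linear conditions leave a one-dimensional space of equations. For the stated
  conic the discriminant is \<open>-4AC\<close>, where \<open>C < 0\<close> and \<open>A = 4u\<^sub>1 - u\<^sub>2\<close>; since
  \<open>u\<^sub>2 / u\<^sub>1\<close> tends to \<open>2\<^sup>p\<close>, the sign of \<open>A\<close> is that of \<open>4 - 2\<^sup>p\<close>.
  The same limit gives \<open>u\<^sub>2 > 2u\<^sub>1\<close>, so \<open>D \<noteq> 0\<close> and the conic is nondegenerate.
\<close>

lemma unique_conic_through_symmetric_points:
  fixes a b e :: real
  assumes "a \<noteq> 0" "b \<noteq> 0" "a \<noteq> b" "e \<noteq> 0"
  shows "unique_conic_through {(0, 0), (a, e), (a, - e), (b, 2 * e), (b, - (2 * e))}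
    (Conic_Eq 0 0 (a * b * (a - b) / e\<^sup>2) (b\<^sup>2 - 4 * a\<^sup>2) 0 (4 * a - b))"
    (is "unique_conic_through ?P (Conic_Eq 0 0 ?C ?D 0 ?A)")
proof -
  have C0: "?C \<noteq> 0" using assms by simp
  have Ce: "?C * e\<^sup>2 = a * b * (a - b)" using assms by simp
  have through_a: "?C * e\<^sup>2 + ?D * a + ?A * a\<^sup>2 = 0"
    unfolding Ce by (simp add: algebra_simps power2_eq_square)
  \<comment> \<open>The square of \<open>2 * e\<close> is split off as a factor 4 first, so that
    \<open>Ce\<close> can rewrite the product and the division by \<open>e\<^sup>2\<close>
    disappears.\<close>
  have "4 * (?C * e\<^sup>2) + ?D * b + ?A * b\<^sup>2 = 0"
    unfolding Ce by (simp add: algebra_simps power2_eq_square)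
  then have through_b: "?C * (2 * e)\<^sup>2 + ?D * b + ?A * b\<^sup>2 = 0"
    using assms by (simp add: power_mult_distrib algebra_simps)
  have "proportional (Conic_Eq 0 0 ?C ?D 0 ?A) q" if q: "is_conic q" "?P \<subseteq> locus q" for q
  proof -
    obtain F E C D B A where q_eq: "q = Conic_Eq F E C D B A" by (cases q)
    have F: "F = 0"
      and a1: "F + E * e + C * e\<^sup>2 + D * a + B * a * e + A * a\<^sup>2 = 0"
      and a2: "F - E * e + C * e\<^sup>2 + D * a - B * a * e + A * a\<^sup>2 = 0"
      and b1: "F + E * (2 * e) + C * (2 * e)\<^sup>2 + D * b + B * b * (2 * e) + A * b\<^sup>2 = 0"
      and b2: "F - E * (2 * e) + C * (2 * e)\<^sup>2 + D * b - B * b * (2 * e) + A * b\<^sup>2 = 0"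
      using q(2) by (simp_all add: q_eq locus_def)
    \<comment> \<open>Subtracting the equations of two mirror points leaves only the terms odd in
      \<open>y\<close>.\<close>
    have "(E + B * a) * e = 0" "(E + B * b) * (2 * e) = 0"
      using a1 a2 b1 b2 by (simp_all add: algebra_simps)
    then have "E + B * a = 0" "E + B * b = 0" using assms by simp_all
    moreover from this have "B * a = B * b" by linarith
    ultimately have B: "B = 0" and E: "E = 0" using assms by simp_all
    \<comment> \<open>This multiple of the stated conic matches \<open>q\<close> in the
      \<open>y\<^sup>2\<close> coefficient. The difference is therefore
      \<open>(d + c * u) * u\<close>, free of \<open>y\<close>; it vanishes at the distinct nonzero
      values \<open>a\<close> and \<open>b\<close>, so \<open>c = d = 0\<close>.\<close>
    define k where "k = C / ?C"
    have C: "C = k * ?C" using C0 unfolding k_def by simp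
    define d where "d = D - k * ?D"
    define c where "c = A - k * ?A"
    have D: "D = d + k * ?D" and A: "A = c + k * ?A" by (simp_all add: d_def c_def)
    have lin: "C * y\<^sup>2 + D * u + A * u\<^sup>2 = k * (?C * y\<^sup>2 + ?D * u + ?A * u\<^sup>2) + (d + c * u) * u"
      for u y
      unfolding C D A by (simp add: algebra_simps power2_eq_square)
    have "(d + c * a) * a = 0" "(d + c * b) * b = 0"
      using lin[of e a] lin[of "2 * e" b] a1 b1 through_a through_b by (simp_all add: F E B)
    then have "d + c * a = 0" "d + c * b = 0" using assms by simp_all
    moreover from this have "c * a = c * b" by linarith
    ultimately have "c = 0" "d = 0" using assms by simp_all
    then have q_scale: "q = scale_conic k (Conic_Eq 0 0 ?C ?D 0 ?A)"
      unfolding q_eq scale_conic_def using C D A F E B by simp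
    moreover have "k \<noteq> 0"
      using q(1) q_scale by (auto simp: is_conic_def scale_conic_def)
    ultimately show ?thesis unfolding proportional_def by blast
  qed
  moreover have "is_conic (Conic_Eq 0 0 ?C ?D 0 ?A)"
    using C0 by (simp add: is_conic_def)
  moreover have "?P \<subseteq> locus (Conic_Eq 0 0 ?C ?D 0 ?A)"
    using through_a through_b by (simp add: locus_def)
  ultimately show ?thesis unfolding unique_conic_through_def by blast
qed

text \<open>The determinant is \<open>- C * D\<^sup>2 / 4\<close>, whatever the value of
  \<open>A\<close>.\<close>

lemma nondegenerate_symmetric_conic:
  assumes "C \<noteq> 0" "D \<noteq> 0"
  shows "nondegenerate (Conic_Eq 0 0 C D 0 A)"
  using assms
  by (simp add: nondegenerate_def conic_matrix_def invertible_det_nz det_3)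

text \<open>On positive bases the powers \<open>p\<close> and \<open>1 / p\<close> are mutually
  inverse; \<open>\<bar>y\<bar> < 1\<close> makes the base \<open>1 - \<bar>y\<bar> powr p\<close>
  positive.\<close>

lemma p_circle_pos_iff:
  assumes "p > 0" "x > 0" "\<bar>y\<bar> < 1"
  shows "(x, y) \<in> p_circle p \<longleftrightarrow> x = (1 - \<bar>y\<bar> powr p) powr (1 / p)"
proof -
  have "\<bar>y\<bar> powr p < 1" using assms powr_less_mono2[of p "\<bar>y\<bar>" 1] by simp
  then have "x powr p = 1 - \<bar>y\<bar> powr p \<longleftrightarrow> x = (1 - \<bar>y\<bar> powr p) powr (1 / p)"
    using assms powr_powr[of x p "1 / p"] powr_powr[of "1 - \<bar>y\<bar> powr p" "1 / p" p] by auto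
  then show ?thesis using assms by (auto simp: p_circle_def)
qed

lemma u_coord_pos:
  assumes "p > 0" "real j * e > 0" "real j * e < 1"
  shows "u_coord p e j > 0"
proof -
  have "0 < (real j * e) powr p"
    using assms(2) by (simp only: powr_gt_zero)
  moreover have "(real j * e) powr p < 1"
    using assms powr_less_mono2[of p "real j * e" 1] by simp
  ultimately show ?thesis
    using assms powr_less_mono2[of "1 / p" "1 - (real j * e) powr p" 1]
    by (simp add: u_coord_def)
qed

lemma p_circle_points_eq_five_points:
  assumes "p > 0" "e > 0" "2 * e < 1"
  shows "(\<lambda>(x, y). (1 - x, y)) `
    {(x, y) \<in> p_circle p. x > 0 \<and> y \<in> {0, e, - e, 2 * e, - (2 * e)}} = five_points p e"
proof -
  define X where "X y = (1 - \<bar>y\<bar> powr p) powr (1 / p)" for y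
  have Xpos: "X y > 0" if "\<bar>y\<bar> < 1" for y
    using that assms powr_less_mono2[of p "\<bar>y\<bar>" 1] by (simp add: X_def)
  \<comment> \<open>The right half of the curve is a graph over \<open>\<bar>y\<bar> < 1\<close>, so
    exactly one point lies above each listed ordinate.\<close>
  have "{(x, y) \<in> p_circle p. x > 0 \<and> y \<in> {0, e, - e, 2 * e, - (2 * e)}} =
    (\<lambda>y. (X y, y)) ` {0, e, - e, 2 * e, - (2 * e)}" (is "?L = _ ` ?Y")
  proof -
    have small: "\<bar>y\<bar> < 1" if "y \<in> ?Y" for y using that assms by auto
    have "(x, y) \<in> ?L \<longleftrightarrow> y \<in> ?Y \<and> x = X y" for x y
      using small[of y] Xpos[of y] p_circle_pos_iff[of p x y] assms(1)
      unfolding X_def by blast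
    then show ?thesis by (auto simp del: insert_iff)
  qed
  then show ?thesis
    using assms by (simp add: five_points_def u_coord_def X_def)
qed

text \<open>To first order \<open>u_coord p e j\<close> is \<open>(j * e) powr p / p\<close> as
  \<open>e\<close> tends to 0, and in the quotient only the factor \<open>2 powr p\<close>
  survives.\<close>

lemma u_coord_ratio_tendsto:
  assumes "p > 0"
  shows "((\<lambda>e. u_coord p e 2 / u_coord p e 1) \<longlongrightarrow> 2 powr p) (at_right 0)"
  unfolding u_coord_def using assms by real_asymp

theorem proposition8:
  fixes p :: real
  assumes "p > 1" and "p \<noteq> 2"
  shows "\<forall>\<^sub>F \<epsilon> in at_right 0.
    2 * \<epsilon> < 1 \<and>
    (\<lambda>(x, y). (1 - x, y)) `
      {(x, y) \<in> p_circle p. x > 0 \<and> y \<in> {0, \<epsilon>, - \<epsilon>, 2 * \<epsilon>, - (2 * \<epsilon>)}} = five_points p \<epsilon> \<and>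
    card (five_points p \<epsilon>) = 5 \<and>
    unique_conic_through (five_points p \<epsilon>) (five_point_conic p \<epsilon>) \<and>
    (p > 2 \<longrightarrow> nondegenerate_ellipse (five_point_conic p \<epsilon>)) \<and>
    (p < 2 \<longrightarrow> nondegenerate_hyperbola (five_point_conic p \<epsilon>))"
proof -
  have powr_two: "(2::real) powr 2 = 4" by simp
  have lim: "((\<lambda>e. u_coord p e 2 / u_coord p e 1) \<longlongrightarrow> 2 powr p) (at_right 0)"
    using assms by (intro u_coord_ratio_tendsto) simp
  \<comment> \<open>Here \<open>p > 1\<close> enters: it places the limit strictly above 2, hence
    also the ratio for small \<open>e\<close>.\<close>
  have "2 powr p > 2" using assms powr_less_mono[of 1 p 2] by simp
  from order_tendstoD(1)[OF lim this]
  have ev2: "\<forall>\<^sub>F e in at_right 0. u_coord p e 2 / u_coord p e 1 > 2" .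
  have ev4: "\<forall>\<^sub>F e in at_right 0. (p > 2 \<longrightarrow> u_coord p e 2 / u_coord p e 1 > 4) \<and>
    (p < 2 \<longrightarrow> u_coord p e 2 / u_coord p e 1 < 4)"
  proof (cases "p > 2")
    case True
    then have "2 powr p > 4" using powr_less_mono[of 2 p 2] powr_two by simp
    from order_tendstoD(1)[OF lim this] show ?thesis
      by eventually_elim (use True in simp)
  next
    case False
    then have "2 powr p < 4" using assms powr_less_mono[of p 2 2] powr_two by simp
    from order_tendstoD(2)[OF lim this] show ?thesis
      by eventually_elim (use False in simp)
  qed
  have "\<forall>\<^sub>F e in at_right (0::real). e > 0 \<and> 2 * e < 1"
    by (auto simp: eventually_at_right_field intro!: exI[of _ "1 / 2"])
  with ev2 ev4 show ?thesis
  proof eventually_elim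
    case (elim e)
    define a where "a = u_coord p e 1"
    define b where "b = u_coord p e 2"
    have e: "e > 0" "2 * e < 1" using elim by auto
    have pos: "a > 0" "b > 0"
      using u_coord_pos[of p 1 e] u_coord_pos[of p 2 e] e assms by (simp_all add: a_def b_def)
    \<comment> \<open>The bounds on the ratio are multiplied by \<open>a > 0\<close>.\<close>
    have b2: "b > 2 * a" and b4: "p > 2 \<Longrightarrow> b > 4 * a" "p < 2 \<Longrightarrow> b < 4 * a"
      using elim pos unfolding a_def[symmetric] b_def[symmetric] by (simp_all add: field_simps)
    have points: "five_points p e = {(0, 0), (a, e), (a, - e), (b, 2 * e), (b, - (2 * e))}"
      by (simp add: five_points_def a_def b_def)
    define C where "C = a * b * (a - b) / e\<^sup>2"
    define D where "D = b\<^sup>2 - 4 * a\<^sup>2"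
    have conic: "five_point_conic p e = Conic_Eq 0 0 C D 0 (4 * a - b)"
      by (simp add: five_point_conic_def Let_def a_def b_def C_def D_def)
    \<comment> \<open>From \<open>b > 2 * a > 0\<close> the factor \<open>a - b\<close> is
      negative.\<close>
    have C: "C < 0" using pos b2 e by (simp add: C_def divide_neg_pos mult_pos_neg)
    have "D = (b - 2 * a) * (b + 2 * a)" by (simp add: D_def algebra_simps power2_eq_square)
    then have D: "D \<noteq> 0" using pos b2 by simp
    have is_conic: "is_conic (five_point_conic p e)" using C by (simp add: is_conic_def conic)
    have nondeg: "nondegenerate (five_point_conic p e)"
      unfolding conic using C D by (intro nondegenerate_symmetric_conic) auto
    have disc: "discriminant (five_point_conic p e) = - (4 * (4 * a - b) * C)"
      by (simp add: discriminant_def conic)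
    \<comment> \<open>The origin witnesses the nonempty real locus required of an ellipse.\<close>
    have "(0, 0) \<in> locus (five_point_conic p e)" by (simp add: locus_def conic)
    moreover have "discriminant (five_point_conic p e) < 0" if "p > 2"
      using b4(1)[OF that] C unfolding disc by (simp add: mult_neg_neg)
    moreover have "discriminant (five_point_conic p e) > 0" if "p < 2"
      using b4(2)[OF that] C unfolding disc by (simp add: mult_pos_neg)
    moreover have "card (five_points p e) = 5"
      using e pos unfolding points by simp
    moreover have "unique_conic_through (five_points p e) (five_point_conic p e)"
      unfolding points conic C_def D_def
      using pos b2 e by (intro unique_conic_through_symmetric_points) auto
    moreover note p_circle_points_eq_five_points[of p e]
    ultimately show ?case
      using e assms is_conic nondeg
      by (auto simp: nondegenerate_ellipse_def nondegenerate_hyperbola_def)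
  qed
qed

end
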